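(* Let $n$ be a positive integer and let $P \subseteq \mathbb{Z}_n$ be a nonempty pitch class set. The antipodal pair multiset $L(P)$ is a T/I invariant: $L(g(P)) = L(P)$ for every $g \in D_n$.
   Context: Elements of $\mathbb{Z}_n$ are represented by integers in $\{0,\ldots,n-1\}$. The dihedral group $D_n$ acts on $\mathbb{Z}_n$ by transpositions $T_s(p) = p+s$ and inversions $I_s(p) = s-p$ (mod $n$), $s \in \mathbb{Z}_n$. Write a nonempty set $P \subseteq \mathbb{Z}_n$ of cardinality $k$ in ascending order $0 \le p_0 < p_1 < \cdots < p_{k-1} < n$. Its step sequence, giving the edge weights of its cycle pitch class graph $C(P)$, is $(w_0,\ldots,w_{k-1})$ with $w_i = p_{i+1}-p_i$ for $0 \le i \le k-2$ and $w_{k-1} = n - p_{k-1} + p_0$; indices of $w$ are read modulo $k$. The antipodal pair multiset of $P$ is the multiset of $k$ unordered pairs (repetition within a pair allowed) $$L(P) = \bigl\{\{\, \{w_i,\ w_{i+\lfloor k/2\rfloor}\} : i = 0, 1, \ldots, k-1 \,\}\bigr\}.$$ *)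

theory Defs
  imports Main "HOL-Library.Multiset" "HOL-Library.Uprod"
begin

definition Zmod :: "int \<Rightarrow> int set" where
  "Zmod n = {0..<n}"

definition transp :: "int \<Rightarrow> int \<Rightarrow> int \<Rightarrow> int" where
  "transp n s p = (p + s) mod n"

definition inversion :: "int \<Rightarrow> int \<Rightarrow> int \<Rightarrow> int" where
  "inversion n s p = (s - p) mod n"

text \<open>The dihedral group, given by the maps through which its elements act on
  \<open>\<int>\<^sub>n\<close>; a map \<open>g\<close> acts on a pitch class set \<open>P\<close> as \<open>g ` P\<close>.
  Only the values of the maps on \<open>Zmod n\<close> matter.\<close>

definition dihedral :: "int \<Rightarrow> (int \<Rightarrow> int) set" where
  "dihedral n = transp n ` Zmod n \<union> inversion n ` Zmod n"

definition step_seq :: "int \<Rightarrow> int set \<Rightarrow> int list" where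
  "step_seq n P =
    (let p = sorted_list_of_set P; k = card P
     in map (\<lambda>i. if i < k - 1 then p ! (i + 1) - p ! i else n - p ! (k - 1) + p ! 0) [0..<k])"

text \<open>Unordered pairs with possible repetition are elements of the type \<open>int uprod\<close>.\<close>

definition antipodal_pairs :: "int \<Rightarrow> int set \<Rightarrow> int uprod multiset" where
  "antipodal_pairs n P =
    (let w = step_seq n P; k = card P
     in {# Upair (w ! i) (w ! ((i + k div 2) mod k)). i \<in># mset_set {0..<k} #})"

end

theory Submission
  imports Defs
begin

text \<open>
  The group \<open>D\<^sub>n\<close> is generated by the transposition \<open>T\<^sub>1\<close> and the reflection \<open>p \<mapsto> n - 1 - p\<close>, so
  these two maps are enough. On the sorted list of \<open>P\<close>, \<open>T\<^sub>1\<close> shifts every entry by one and, if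
  \<open>n - 1\<close> was present, moves it to the front as \<open>0\<close>; the step sequence is thus kept or rotated
  by one place (\<open>gaps_wrap\<close>). The reflection reverses the list, and the step sequence is reversed up
  to a rotation (\<open>gaps_reflect\<close>).

  The multiset of pairs \<open>{w\<^sub>i, w\<^sub>i\<^sub>+\<^sub>m}\<close>, \<open>m = \<lfloor>k/2\<rfloor>\<close>, survives both operations on \<open>w\<close>: a
  rotation only reindexes it, and a reversal replaces each index \<open>i\<close> by \<open>c - i\<close> for a constant \<open>c\<close>, so
  that the new pair of index \<open>i\<close> is the old pair of index \<open>c - i - m\<close> with its components exchanged.
  This holds for pairs at any fixed cyclic distance \<open>m\<close> (\<open>cyclic_pairs_rotate1\<close>,
  \<open>cyclic_pairs_rev\<close>).
\<close>

section \<open>Pairs at a fixed cyclic distance\<close>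

definition cyclic_pairs :: "nat \<Rightarrow> 'a list \<Rightarrow> 'a uprod multiset" where
  "cyclic_pairs m w = mset (map2 Upair w (rotate m w))"

lemma zip_rotate1:
  "length xs = length ys \<Longrightarrow> zip (rotate1 xs) (rotate1 ys) = rotate1 (zip xs ys)"
  by (cases xs; cases ys) auto

lemma zip_rotate:
  "length xs = length ys \<Longrightarrow> zip (rotate m xs) (rotate m ys) = rotate m (zip xs ys)"
  by (induction m) (simp_all add: zip_rotate1)

lemma mset_rotate1: "mset (rotate1 xs) = mset xs"
  by (cases xs) simp_all

lemma mset_rotate: "mset (rotate m xs) = mset xs"
  by (induction m) (simp_all add: mset_rotate1)

lemma cyclic_pairs_rotate1: "cyclic_pairs m (rotate1 w) = cyclic_pairs m w"
proof -
  have "map2 Upair (rotate1 w) (rotate m (rotate1 w)) = rotate1 (map2 Upair w (rotate m w))"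
    by (simp add: rotate1_rotate_swap[symmetric] zip_rotate1 rotate1_map)
  then show ?thesis
    by (simp only: cyclic_pairs_def mset_rotate1)
qed

lemma cyclic_pairs_rev: "cyclic_pairs m (rev w) = cyclic_pairs m w"
proof -
  \<comment> \<open>Reversal turns the rotation by \<open>m\<close> into its inverse, the rotation by \<open>r\<close>; rotating both
    components by \<open>m\<close> then brings the pairs back with their components exchanged.\<close>
  define r where "r = length w - m mod length w"
  have undo: "rotate m (rotate r w) = w"
  proof (cases "w = []")
    case False
    have "(m + r) mod length w = (m mod length w + r) mod length w"
      by (simp add: mod_add_left_eq)
    also have "m mod length w + r = length w"
      using False by (simp add: r_def less_imp_le)
    finally show ?thesis by (simp add: rotate_rotate rotate_id)
  qed simp
  have "rotate m (rev w) = rev (rotate r w)"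
    by (simp add: rotate_rev r_def)
  then have "cyclic_pairs m (rev w) = mset (map2 Upair w (rotate r w))"
    by (simp add: cyclic_pairs_def zip_rev rev_map[symmetric] del: mset_map)
  also have "\<dots> = mset (rotate m (map2 Upair w (rotate r w)))"
    by (simp only: mset_rotate)
  also have "rotate m (map2 Upair w (rotate r w)) = map2 Upair (rotate m w) w"
    by (simp add: rotate_map zip_rotate[symmetric] undo)
  also have "map2 Upair (rotate m w) w = map2 Upair w (rotate m w)"
    by (auto intro: nth_equalityI simp: Upair_inject)
  finally show ?thesis by (simp add: cyclic_pairs_def)
qed

section \<open>Step sequences of sorted lists\<close>

definition gaps :: "int \<Rightarrow> int list \<Rightarrow> int list" where
  "gaps n xs = map2 (-) (tl xs @ [hd xs + n]) xs"

lemma length_gaps [simp]: "xs \<noteq> [] \<Longrightarrow> length (gaps n xs) = length xs"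
  by (simp add: gaps_def)

lemma nth_gaps:
  "i < length xs \<Longrightarrow>
    gaps n xs ! i = (if i < length xs - 1 then xs ! (i + 1) - xs ! i else n - xs ! i + xs ! 0)"
  by (cases "xs = []") (auto simp: gaps_def nth_append nth_tl hd_conv_nth)

lemma gaps_shift: "xs \<noteq> [] \<Longrightarrow> gaps n (map (\<lambda>x. x + c) xs) = gaps n xs"
  by (rule nth_equalityI) (auto simp: nth_gaps)

text \<open>The entry \<open>x + n\<close> is the class of \<open>x\<close> seen one turn later, so moving \<open>x\<close> from the front to
  the back traverses the same cycle from a start one place later.\<close>

lemma gaps_wrap: "gaps n (xs @ [x + n]) = rotate1 (gaps n (x # xs))"
proof (cases xs)
  case (Cons a ys)
  then show ?thesis
    using zip_append[of "ys @ [x + n]" "a # ys" "[a + n]" "[x + n]"] by (simp add: gaps_def)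
qed (simp add: gaps_def)

text \<open>Reversing \<open>w\<close> brings the closing gap, from the largest entry round to the smallest, to the
  front; after the reflection it still joins the last entry to the first, hence the rotation.\<close>

lemma gaps_reflect:
  assumes "xs \<noteq> []"
  shows "gaps n (rev (map (\<lambda>x. c - x) xs)) = rotate1 (rev (gaps n xs))"
proof (rule nth_equalityI)
  fix i assume "i < length (gaps n (rev (map (\<lambda>x. c - x) xs)))"
  then have i: "i < length xs" using assms by simp
  show "gaps n (rev (map (\<lambda>x. c - x) xs)) ! i = rotate1 (rev (gaps n xs)) ! i"
  proof (cases "Suc i < length xs")
    case True
    then have "Suc (length xs - Suc (Suc i)) = length xs - Suc i" by simp
    then show ?thesis
      using True assms by (simp add: nth_gaps nth_rotate1 rev_nth)
  next
    case False
    then have "length xs = Suc i" using i by simp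
    then show ?thesis
      using assms by (simp add: nth_gaps nth_rotate1 rev_nth)
  qed
qed (use assms in simp)

lemma sorted_list_of_set_strict:
  fixes xs :: "'a::linorder list"
  shows "sorted_wrt (<) xs \<Longrightarrow> sorted_list_of_set (set xs) = xs"
  by (simp add: strict_sorted_iff sorted_list_of_set.idem_if_sorted_distinct)

lemma antipodal_pairs_set:
  assumes "sorted_wrt (<) xs" "xs \<noteq> []"
  shows "antipodal_pairs n (set xs) = cyclic_pairs (length xs div 2) (gaps n xs)"
proof -
  let ?k = "length xs" and ?w = "gaps n xs"
  have k: "card (set xs) = ?k"
    using assms(1) by (simp add: distinct_card strict_sorted_iff)
  have w: "step_seq n (set xs) = ?w"
    unfolding step_seq_def Let_def k sorted_list_of_set_strict[OF assms(1)]
    using assms(2) by (intro nth_equalityI) (auto simp: nth_gaps dest: less_antisym)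
  have "map2 Upair ?w (rotate (?k div 2) ?w)
      = map (\<lambda>i. Upair (?w ! i) (?w ! ((i + ?k div 2) mod ?k))) [0..<?k]"
    using assms(2) by (intro nth_equalityI) (auto simp: nth_rotate add.commute)
  then have "cyclic_pairs (?k div 2) ?w
      = image_mset (\<lambda>i. Upair (?w ! i) (?w ! ((i + ?k div 2) mod ?k))) (mset [0..<?k])"
    by (simp only: cyclic_pairs_def mset_map)
  then show ?thesis
    by (simp add: antipodal_pairs_def Let_def k w)
qed

lemma Zmod_subset_as_list:
  assumes "P \<subseteq> Zmod n" "P \<noteq> {}"
  obtains xs where "P = set xs" "sorted_wrt (<) xs" "xs \<noteq> []"
proof -
  have "finite P"
    using assms(1) by (rule finite_subset) (simp add: Zmod_def)
  then show thesis
    using assms(2) by (intro that[of "sorted_list_of_set P"]) auto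
qed

section \<open>Invariance under the generators\<close>

lemma antipodal_pairs_transp_1:
  assumes "P \<subseteq> Zmod n" "P \<noteq> {}"
  shows "antipodal_pairs n (transp n 1 ` P) = antipodal_pairs n P"
proof -
  obtain xs where P: "P = set xs" and sorted: "sorted_wrt (<) xs" and "xs \<noteq> []"
    using assms by (rule Zmod_subset_as_list)
  obtain qs x where xs: "xs = qs @ [x]"
    using \<open>xs \<noteq> []\<close> by (metis rev_exhaust)
  have less: "\<forall>q\<in>set qs. 0 \<le> q \<and> q < x" and x: "0 \<le> x" "x < n" and qs: "sorted_wrt (<) qs"
    using assms(1) sorted by (auto simp: P xs Zmod_def sorted_wrt_append)
  have qs': "transp n 1 ` set qs = (\<lambda>q. q + 1) ` set qs"
    using less x by (intro image_cong) (auto simp: transp_def)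
  show ?thesis
  proof (cases "x = n - 1")
    case False
    have "transp n 1 ` P = set (map (\<lambda>q. q + 1) xs)"
    proof -
      have "transp n 1 x = x + 1"
        using False x by (simp add: transp_def)
      then show ?thesis
        by (simp add: P xs qs')
    qed
    moreover have "sorted_wrt (<) (map (\<lambda>q. q + 1) xs)"
      using sorted by (simp only: sorted_wrt_map add_less_cancel_right)
    ultimately have "antipodal_pairs n (transp n 1 ` P)
        = cyclic_pairs (length xs div 2) (gaps n (map (\<lambda>q. q + 1) xs))"
      using \<open>xs \<noteq> []\<close> antipodal_pairs_set[of "map (\<lambda>q. q + 1) xs" n] by simp
    then show ?thesis
      using \<open>xs \<noteq> []\<close> sorted by (simp add: gaps_shift P antipodal_pairs_set)
  next
    case True
    let ?ys = "0 # map (\<lambda>q. q + 1) qs"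
    have "transp n 1 x = 0"
      using True by (simp add: transp_def)
    then have "transp n 1 ` P = set ?ys"
      by (simp add: P xs qs')
    moreover have "sorted_wrt (<) (map (\<lambda>q. q + 1) qs)"
      using qs by (simp only: sorted_wrt_map add_less_cancel_right)
    then have "sorted_wrt (<) ?ys"
      using less by auto
    ultimately have "antipodal_pairs n (transp n 1 ` P)
        = cyclic_pairs (length xs div 2) (gaps n ?ys)"
      using antipodal_pairs_set[of ?ys n] by (simp add: xs)
    also have "\<dots> = cyclic_pairs (length xs div 2) (gaps n (map (\<lambda>q. q + 1) qs @ [0 + n]))"
      by (simp only: gaps_wrap cyclic_pairs_rotate1)
    also have "map (\<lambda>q. q + 1) qs @ [0 + n] = map (\<lambda>q. q + 1) xs"
      using True by (simp add: xs)
    finally show ?thesis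
      using \<open>xs \<noteq> []\<close> sorted by (simp add: gaps_shift P antipodal_pairs_set)
  qed
qed

lemma antipodal_pairs_reflect:
  assumes "P \<subseteq> Zmod n" "P \<noteq> {}"
  shows "antipodal_pairs n ((\<lambda>p. c - p) ` P) = antipodal_pairs n P"
proof -
  obtain xs where P: "P = set xs" and sorted: "sorted_wrt (<) xs" and "xs \<noteq> []"
    using assms by (rule Zmod_subset_as_list)
  let ?ys = "rev (map (\<lambda>p. c - p) xs)"
  have "sorted_wrt (<) ?ys"
    using sorted by (simp add: sorted_wrt_map sorted_wrt_rev)
  then have "antipodal_pairs n (set ?ys) = cyclic_pairs (length xs div 2) (gaps n ?ys)"
    using \<open>xs \<noteq> []\<close> antipodal_pairs_set[of ?ys n] by simp
  then show ?thesis
    using \<open>xs \<noteq> []\<close> sorted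
    by (simp add: gaps_reflect cyclic_pairs_rotate1 cyclic_pairs_rev P antipodal_pairs_set)
qed

section \<open>Invariance under the dihedral group\<close>

lemma antipodal_pairs_transp:
  assumes "n > 0" "P \<subseteq> Zmod n" "P \<noteq> {}"
  shows "antipodal_pairs n (transp n (int s) ` P) = antipodal_pairs n P"
proof (induction s)
  case 0
  have "transp n 0 ` P = id ` P"
    using assms(2) by (intro image_cong) (auto simp: transp_def Zmod_def)
  then show ?case by simp
next
  case (Suc s)
  have "transp n (int (Suc s)) ` P = transp n 1 ` (transp n (int s) ` P)"
    by (simp add: image_image transp_def mod_add_left_eq add.assoc add.commute[of 1 "int s"])
  moreover have "transp n (int s) ` P \<subseteq> Zmod n"
    using assms(1) by (auto simp: transp_def Zmod_def)
  ultimately show ?case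
    using Suc.IH assms(3) by (simp add: antipodal_pairs_transp_1)
qed

theorem mainTheorem8:
  fixes n :: int and P :: "int set" and g :: "int \<Rightarrow> int"
  assumes "n > 0"
    and "P \<subseteq> Zmod n" and "P \<noteq> {}"
    and "g \<in> dihedral n"
  shows "antipodal_pairs n (g ` P) = antipodal_pairs n P"
proof -
  from assms(4) consider s where "0 \<le> s" "g = transp n s" | s where "0 \<le> s" "g = inversion n s"
    by (auto simp: dihedral_def Zmod_def)
  then show ?thesis
  proof cases
    case 1
    then show ?thesis
      using antipodal_pairs_transp[OF assms(1-3), of "nat s"] by simp
  next
    case 2
    let ?Q = "(\<lambda>p. (n - 1) - p) ` P"
    have "g ` P = transp n (s + 1) ` ?Q"
    proof -
      have "(s - p) mod n = (n - 1 - p + (s + 1)) mod n" for p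
        using mod_add_self1[of n "s - p"] by (simp add: algebra_simps)
      then show ?thesis
        using 2 by (simp add: image_image transp_def inversion_def)
    qed
    moreover have "?Q \<subseteq> Zmod n" "?Q \<noteq> {}"
      using assms(2,3) by (auto simp: Zmod_def)
    ultimately have "antipodal_pairs n (g ` P) = antipodal_pairs n ?Q"
      using antipodal_pairs_transp[OF assms(1), of ?Q "nat (s + 1)"] 2 by simp
    also have "\<dots> = antipodal_pairs n P"
      using assms(2,3) by (rule antipodal_pairs_reflect)
    finally show ?thesis .
  qed
qed

end
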